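(* Let $n\ge3$ be an integer. For $a,b\in\mathbb{R}\setminus\{0\}$ let $\mathcal{B}^n_{a,b}(\lambda)$ be the polynomial in $\lambda$ defined in the context. There exist finitely many real numbers $r_1,\dots,r_p\in\mathbb{R}$ such that for all $(a,b)$ with $a/b\notin\{r_1,\dots,r_p\}$, $$\deg\mathcal{B}^n_{a,b}=\begin{cases}\dfrac{n^2-1}{4}&\text{if }n\text{ is odd},\\[2mm]\dfrac{n^2}{4}-1&\text{if }n\text{ is even.}\end{cases}$$
   Context: For $a,b\in\mathbb{R}\setminus\{0\}$ and $\lambda\in\mathbb{C}$, define $B_k(\lambda)$ ($k\ge0$) as the coefficients of the Taylor expansion at $t=0$ $$\sqrt{\Big(\tfrac{a-\lambda}{a}t+1\Big)\Big(\tfrac{b-\lambda}{b}t+1\Big)(t+1)}=\sum_{k\ge0}B_k(\lambda)t^k,$$ with the branch equal to $1$ at $t=0$; each $B_k$ is a polynomial in $\lambda$. The polynomial $\mathcal{B}^n_{a,b}$ is the determinant $$\mathcal{B}^n_{a,b}(\lambda)=\det\big(B_{i+j}(\lambda)\big)_{1\le i,j\le m}\quad\text{if }n=2m+1,\qquad \mathcal{B}^n_{a,b}(\lambda)=\det\big(B_{i+j+1}(\lambda)\big)_{1\le i,j\le m-1}\quad\text{if }n=2m.$$ (The degree is with respect to $\lambda$.) *)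

theory Defs
  imports "HOL-Complex_Analysis.Complex_Analysis" "Jordan_Normal_Form.Determinant"
begin

text \<open>
  The Taylor coefficients at \<open>t = 0\<close>. The radicand equals \<open>1\<close> at \<open>t = 0\<close>, so near \<open>0\<close> the principal
  root \<^const>\<open>csqrt\<close> is the holomorphic branch with value \<open>1\<close> at \<open>t = 0\<close>, which is
  all that \<^const>\<open>fps_expansion\<close> depends on.
\<close>

definition B_coeff :: "real \<Rightarrow> real \<Rightarrow> nat \<Rightarrow> complex \<Rightarrow> complex" where
  "B_coeff a b k l =
     fps_nth (fps_expansion
       (\<lambda>t. csqrt (((of_real a - l) / of_real a * t + 1) *
                   ((of_real b - l) / of_real b * t + 1) * (t + 1))) 0) k"

text \<open>
  The polynomial in \<open>\<lambda>\<close> whose polynomial function is \<^term>\<open>B_coeff a b k\<close>. It exists by the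
  lemma \<open>poly_B_poly\<close> below and is unique because \<^typ>\<open>complex\<close> is infinite.
\<close>

definition B_poly :: "real \<Rightarrow> real \<Rightarrow> nat \<Rightarrow> complex poly" where
  "B_poly a b k = (THE p. \<forall>l. poly p l = B_coeff a b k l)"

text \<open>
  Matrix indices start at \<open>0\<close> in the library, hence \<^const>\<open>Suc\<close>. For \<open>n = 2 * m + 1\<close> and
  \<open>n = 2 * m\<close> alike, \<open>m = n div 2\<close>.
\<close>

definition cayley_det_poly :: "nat \<Rightarrow> real \<Rightarrow> real \<Rightarrow> complex poly" where
  "cayley_det_poly n a b =
     (let m = n div 2 in
      if odd n
      then Determinant.det (Matrix.mat m m (\<lambda>(i, j). B_poly a b (Suc i + Suc j)))
      else Determinant.det (Matrix.mat (m - 1) (m - 1) (\<lambda>(i, j). B_poly a b (Suc i + Suc j + 1))))"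


lemma B_coeff_fps_square:
  fixes a b :: real and l :: complex
  defines "F \<equiv> fps_expansion
       (\<lambda>t. csqrt (((of_real a - l) / of_real a * t + 1) *
                   ((of_real b - l) / of_real b * t + 1) * (t + 1))) 0"
  shows "F * F = (fps_const ((of_real a - l) / of_real a) * fps_X + 1) *
                 (fps_const ((of_real b - l) / of_real b) * fps_X + 1) * (fps_X + 1)"
    and "fps_nth F 0 = 1"
proof -
  define g where "g = (\<lambda>t. ((of_real a - l) / of_real a * t + 1) *
                   ((of_real b - l) / of_real b * t + 1) * (t + 1))"
  have F: "F = fps_expansion (\<lambda>t. csqrt (g t)) 0"
    by (simp add: F_def g_def)
  have "(\<lambda>t. csqrt (g t)) analytic_on {0}"
  proof (rule analytic_on_compose[of g _ csqrt, unfolded comp_def])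
    show "g analytic_on {0}" unfolding g_def by (intro analytic_intros)
    have "csqrt holomorphic_on - \<real>\<^sub>\<le>\<^sub>0"
      by (intro holomorphic_on_csqrt)
    then have "csqrt analytic_on - \<real>\<^sub>\<le>\<^sub>0"
      by (subst analytic_on_open) (simp_all add: open_Compl)
    then show "csqrt analytic_on (g ` {0})"
      by (rule analytic_on_subset) (simp add: g_def)
  qed
  then have 1: "(\<lambda>t. csqrt (g t)) has_fps_expansion F"
    unfolding F by (rule analytic_at_imp_has_fps_expansion_0)
  have "(\<lambda>t. csqrt (g t) * csqrt (g t)) has_fps_expansion F * F"
    by (intro has_fps_expansion_mult 1)
  then have "g has_fps_expansion F * F"
    by (simp add: power2_eq_square[symmetric])
  moreover have "g has_fps_expansion (fps_const ((of_real a - l) / of_real a) * fps_X + 1) *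
                 (fps_const ((of_real b - l) / of_real b) * fps_X + 1) * (fps_X + 1)"
    unfolding g_def by (intro fps_expansion_intros)
  ultimately show "F * F = (fps_const ((of_real a - l) / of_real a) * fps_X + 1) *
                 (fps_const ((of_real b - l) / of_real b) * fps_X + 1) * (fps_X + 1)"
    using fps_expansion_unique_complex by blast
  show "fps_nth F 0 = 1"
    by (simp add: F g_def fps_expansion_def)
qed

lemma B_coeff_polyfun: "\<exists>p. \<forall>l. poly p l = B_coeff a b k l"
proof -
  define pf :: "(complex \<Rightarrow> complex) \<Rightarrow> bool" where "pf g \<longleftrightarrow> (\<exists>p. \<forall>l. poly p l = g l)" for g
  have pf_const: "pf (\<lambda>_. c)" for c
    unfolding pf_def by (rule exI[of _ "[:c:]"]) simp
  have pf_id: "pf (\<lambda>l. l)"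
    unfolding pf_def by (rule exI[of _ "[:0, 1:]"]) simp
  have pf_add: "pf (\<lambda>l. f l + g l)" if "pf f" "pf g" for f g
    using that unfolding pf_def by (metis poly_add)
  have pf_diff: "pf (\<lambda>l. f l - g l)" if "pf f" "pf g" for f g
    using that unfolding pf_def by (metis poly_diff)
  have pf_mult: "pf (\<lambda>l. f l * g l)" if "pf f" "pf g" for f g
    using that unfolding pf_def by (metis poly_mult)
  have pf_sum: "pf (\<lambda>l. \<Sum>i\<in>A. f i l)" if "\<And>i. i \<in> A \<Longrightarrow> pf (f i)" for A :: "nat set" and f
    using that by (induction A rule: infinite_finite_induct) (auto intro!: pf_const pf_add)
  have pf_fps_mult: "pf (\<lambda>l. fps_nth (F l * G l) k)"
    if "\<And>k. pf (\<lambda>l. fps_nth (F l) k)" "\<And>k. pf (\<lambda>l. fps_nth (G l) k)" for F G k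
    unfolding fps_mult_nth by (intro pf_sum pf_mult that)
  have pf_lin: "pf (\<lambda>l. fps_nth (fps_const ((c - l) / c) * fps_X + 1) k)" for c k
  proof -
    have "pf (\<lambda>l. (c - l) * inverse c)"
      by (intro pf_diff pf_mult pf_const pf_id)
    then have "pf (\<lambda>l. (c - l) / c)" by (simp add: divide_inverse)
    then show ?thesis
      by (cases "k \<le> 1") (auto simp: le_Suc_eq pf_const)
  qed
  define P where "P l = (fps_const ((of_real a - l) / of_real a) * fps_X + 1) *
                 (fps_const ((of_real b - l) / of_real b) * fps_X + 1) * (fps_X + 1)" for l :: complex
  have pf_P: "pf (\<lambda>l. fps_nth (P l) k)" for k
    unfolding P_def by (intro pf_fps_mult pf_lin pf_const)
  have B0: "B_coeff a b 0 l = 1" for l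
    using B_coeff_fps_square(2) by (simp add: B_coeff_def)
  have BP: "(\<Sum>i=0..k. B_coeff a b i l * B_coeff a b (k - i) l) = fps_nth (P l) k" for k l
    unfolding B_coeff_def P_def B_coeff_fps_square(1)[symmetric] fps_mult_nth ..
  have "pf (B_coeff a b k)"
  proof (induction k rule: less_induct)
    case (less k)
    show ?case
    proof (cases "k = 0")
      case True
      then show ?thesis using B0 pf_const[of 1] by (simp add: fun_eq_iff pf_def)
    next
      case False
      have "B_coeff a b k l =
            (1/2) * (fps_nth (P l) k - (\<Sum>i\<in>{1..<k}. B_coeff a b i l * B_coeff a b (k - i) l))" for l
      proof -
        have "{0..k} = insert 0 (insert k {1..<k})" using False by auto
        then have "fps_nth (P l) k = 2 * B_coeff a b k l +
            (\<Sum>i\<in>{1..<k}. B_coeff a b i l * B_coeff a b (k - i) l)"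
          using False by (simp add: BP[symmetric] B0)
        then show ?thesis by simp
      qed
      then have "B_coeff a b k = (\<lambda>l.
            (1/2) * (fps_nth (P l) k - (\<Sum>i\<in>{1..<k}. B_coeff a b i l * B_coeff a b (k - i) l)))"
        by blast
      moreover have "pf \<dots>"
        using less.IH by (intro pf_mult pf_diff pf_const pf_P pf_sum) auto
      ultimately show ?thesis by simp
    qed
  qed
  then show ?thesis by (simp add: pf_def)
qed

lemma poly_B_poly: "poly (B_poly a b k) l = B_coeff a b k l"
proof -
  have "\<exists>!p. \<forall>l. poly p l = B_coeff a b k l"
    by (metis (no_types, lifting) B_coeff_polyfun ext poly_eq_poly_eq_iff)
  from theI'[OF this] show ?thesis by (simp add: B_poly_def)
qed

end

theory Submission
  imports Defs
begin

text \<open>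
  Since \<open>\<lambda>\<close> enters the radicand only through the product \<open>\<lambda> t\<close>, the Taylor coefficient \<open>B\<^sub>k\<close> has
  degree at most \<open>k\<close> in \<open>\<lambda>\<close>, and its coefficient at \<open>\<lambda>\<^sup>k\<close> is the \<open>k\<close>-th Taylor
  coefficient of \<open>\<surd>((1 - s/a) (1 - s/b))\<close>: the factor
  \<open>t + 1\<close> disappears in the limit \<open>t = s/\<lambda>\<close>, \<open>\<lambda> \<rightarrow> \<infinity>\<close>. With \<open>r = a/b\<close> this number is
  \<open>(-1/a)\<^sup>k g\<^sub>k(r)\<close>, where \<open>\<surd>((1 + x) (1 + r x)) = \<Sum> g\<^sub>k(r) x\<^sup>k\<close> and \<open>g\<^sub>k\<close> is a polynomial
  (lemma \<open>B_poly_top\<close>).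

  The terms of the Leibniz formula for a Hankel determinant of the \<open>B\<^sub>k\<close> therefore share one degree
  bound, the sum \<open>d\<close> of the subscripts along a permutation, and the degree claimed in the
  theorem is this \<open>d\<close>. The coefficient there is \<open>(-1/a)\<^sup>d\<close> times the Hankel determinant \<open>D(r)\<close> of the
  \<open>g\<^sub>k(r)\<close> (lemmas \<open>det_graded\<close> and \<open>det_scaled_by_weights\<close>). So the exceptional ratios are the
  real roots of the polynomial \<open>D\<close>, and it remains to see that \<open>D\<close> is not the zero polynomial.

  It is enough that \<open>D(0) \<noteq> 0\<close>, and \<open>D(0)\<close> is a Hankel determinant of the Taylor coefficients of
  \<open>\<surd>(1 + x)\<close>. More generally, no Hankel determinant of the Taylor coefficients of
  \<open>f = (1 + x)\<^sup>c\<close> vanishes when \<open>c\<close> is not an integer (lemma \<open>det_binomial_Hankel_nonzero\<close>). This is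
  a Pade argument: a kernel vector gives a polynomial \<open>q\<close> such that \<open>q f\<close> has a long
  gap in its expansion, that is, a polynomial \<open>p\<close> approximating \<open>q f\<close> too well. The Wronskian of \<open>p\<close>
  and \<open>q f\<close> then vanishes to high order. By the differential equation \<open>(1 + x) f' = c f\<close>, it is up
  to a factor invertible at the origin the polynomial \<open>(1 + x) (p q' - p' q) + c p q\<close>, whose degree
  is too small for such a zero. So this polynomial is \<open>0\<close>, but its coefficient at \<open>deg p + deg q\<close> is
  \<open>deg q - deg p + c\<close> times the leading coefficients of \<open>p\<close> and \<open>q\<close>, hence not \<open>0\<close>.
\<close>

section \<open>Hankel determinants of a binomial series\<close>

lemma fps_mult_nth_eq_0:
  fixes F G :: "'a :: comm_ring_1 fps"
  assumes "\<And>i. i < n \<Longrightarrow> fps_nth G i = 0" and "i < n"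
  shows "fps_nth (F * G) i = 0"
  using assms by (simp add: fps_mult_nth sum.neutral)

lemma coeff_mult_graded:
  fixes p q :: "'a :: comm_semiring_1 poly"
  assumes "degree p \<le> m" "degree q \<le> n"
  shows "coeff (p * q) (m + n) = coeff p m * coeff q n"
proof -
  have "coeff (p * q) (m + n) = (\<Sum>i\<le>m+n. if i = m then coeff p m * coeff q n else 0)"
    unfolding coeff_mult
  proof (rule sum.cong)
    fix i assume "i \<in> {..m+n}"
    show "coeff p i * coeff q (m + n - i) = (if i = m then coeff p m * coeff q n else 0)"
      using assms by (cases i m rule: linorder_cases) (auto simp: coeff_eq_0)
  qed simp
  then show ?thesis by simp
qed

lemma one_plus_X_pderiv:
  fixes p :: "'a :: idom poly"
  shows "degree ([:1, 1:] * pderiv p) \<le> degree p"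
    and "coeff ([:1, 1:] * pderiv p) (degree p) = of_nat (degree p) * lead_coeff p"
proof -
  show "degree ([:1, 1:] * pderiv p) \<le> degree p"
  proof (intro degree_le allI impI)
    fix i assume "i > degree p"
    then show "coeff ([:1, 1:] * pderiv p) i = 0"
      by (cases i) (simp_all add: coeff_pderiv coeff_eq_0)
  qed
  show "coeff ([:1, 1:] * pderiv p) (degree p) = of_nat (degree p) * lead_coeff p"
    by (cases "degree p") (simp_all add: coeff_pderiv coeff_eq_0)
qed

text \<open>
  If the expression vanished, \<open>p / q\<close> would solve \<open>(1 + x) y' = a y\<close>, so its growth rate
  \<open>deg p - deg q\<close> at infinity would have to be \<open>a\<close>. This shows in the coefficient at
  \<open>deg p + deg q\<close>.
\<close>

lemma binomial_ode_no_polynomial_pair: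
  fixes p q :: "'a :: field_char_0 poly"
  assumes a: "a \<notin> \<int>" and p: "p \<noteq> 0" and q: "q \<noteq> 0"
  shows "[:1, 1:] * (p * pderiv q - pderiv p * q) + Polynomial.smult a (p * q) \<noteq> 0" (is "?t \<noteq> 0")
proof
  assume t0: "?t = 0"
  let ?m = "degree p" and ?n = "degree q"
  have "?t = p * ([:1, 1:] * pderiv q) - ([:1, 1:] * pderiv p) * q + Polynomial.smult a (p * q)"
    by (simp add: algebra_simps)
  then have "coeff ?t (?m + ?n) =
      lead_coeff p * (of_nat ?n * lead_coeff q) - (of_nat ?m * lead_coeff p) * lead_coeff q
      + a * (lead_coeff p * lead_coeff q)"
    by (simp only: coeff_add coeff_diff coeff_smult coeff_mult_graded one_plus_X_pderiv order_refl)
  also have "\<dots> = (of_nat ?n - of_nat ?m + a) * (lead_coeff p * lead_coeff q)"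
    by (simp add: algebra_simps)
  finally have "(of_nat ?n - of_nat ?m + a) * (lead_coeff p * lead_coeff q) = 0"
    unfolding t0 by simp
  then have "of_nat ?n - of_nat ?m + a = 0" using p q by simp
  then have "a = of_int (int ?m - int ?n)"
    by (simp add: algebra_simps eq_neg_iff_add_eq_0)
  then show False using a by auto
qed

text \<open>
  The Pade argument. With \<open>M\<close> unknown coefficients for \<open>q\<close>, the \<open>M\<close> equations of the kernel remove
  the coefficients of \<open>q f\<close> at \<open>L, \<dots>, L + M - 1\<close>, where \<open>L = M - 1 + k\<close>; the truncation \<open>p\<close> of \<open>q f\<close>
  below \<open>L\<close> is thus exact up to order \<open>N = L + M\<close>. The Wronskian loses one order by differentiation,
  and \<open>deg p + deg q \<le> (L - 1) + (M - 1) < N - 1\<close> is just small enough.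
\<close>

lemma det_binomial_Hankel_nonzero:
  fixes a :: "'a :: field_char_0"
  assumes a: "a \<notin> \<int>"
  shows "Determinant.det (Matrix.mat M M (\<lambda>(i, j). a gchoose (i + j + k))) \<noteq> 0"
    (is "Determinant.det ?A \<noteq> 0")
proof
  assume "Determinant.det ?A = 0"
  then obtain v where v: "v \<in> carrier_vec M" "v \<noteq> 0\<^sub>v M" "?A *\<^sub>v v = 0\<^sub>v M"
    by (subst (asm) det_0_iff_vec_prod_zero[of _ M]) auto
  define f where "f = fps_binomial a"
  have ker: "(\<Sum>j<M. vec_index v j * (a gchoose (i + j + k))) = 0" if "i < M" for i
  proof -
    have "0 = vec_index (?A *\<^sub>v v) i" using that v by simp
    also have "\<dots> = (\<Sum>j<M. vec_index v j * (a gchoose (i + j + k)))"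
      using that v(1) by (simp add: scalar_prod_def lessThan_atLeast0 mult.commute)
    finally show ?thesis by simp
  qed
  \<comment> \<open>The order of the entries is reversed because the Hankel sum then is a Cauchy product.\<close>
  define q where "q = (\<Sum>j<M. monom (vec_index v j) (M - 1 - j))"
  have coeff_q: "coeff q n = (if n < M then vec_index v (M - 1 - n) else 0)" for n
  proof -
    have "coeff q n = (\<Sum>j<M. if j = M - 1 - n \<and> n < M then vec_index v j else 0)"
      unfolding q_def coeff_sum coeff_monom by (intro sum.cong) auto
    also have "\<dots> = (if n < M then vec_index v (M - 1 - n) else 0)"
      by (cases "n < M") auto
    finally show ?thesis .
  qed
  obtain j0 where j0: "j0 < M" "vec_index v j0 \<noteq> 0"
    using v(1,2) by (metis carrier_vecD eq_vecI index_zero_vec(1) index_zero_vec(2))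
  have "coeff q (M - 1 - j0) \<noteq> 0" using j0 by (simp add: coeff_q)
  then have q0: "q \<noteq> 0" by auto
  define L N where "L = M - 1 + k" and "N = 2 * M - 1 + k"
  define Q where "Q = fps_of_poly q"
  define p where "p = truncate_fps L (Q * f)"
  define P where "P = fps_of_poly p"
  define E where "E = P - Q * f"
  have gap: "fps_nth (Q * f) (L + i) = 0" if "i < M" for i
  proof -
    have "fps_nth (Q * f) (L + i) = (\<Sum>n=0..L+i. coeff q n * (a gchoose (L + i - n)))"
      by (simp add: fps_mult_nth Q_def f_def)
    also have "\<dots> = (\<Sum>n<M. coeff q n * (a gchoose (L + i - n)))"
      using that by (intro sum.mono_neutral_right) (auto simp: L_def coeff_q)
    also have "\<dots> = (\<Sum>j<M. coeff q (M - Suc j) * (a gchoose (L + i - (M - Suc j))))"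
      by (rule sum.nat_diff_reindex[symmetric])
    also have "\<dots> = (\<Sum>j<M. vec_index v j * (a gchoose (i + j + k)))"
      by (intro sum.cong) (auto simp: coeff_q L_def intro!: arg_cong[of _ _ "(gchoose) a"])
    finally show ?thesis using ker[OF that] by simp
  qed
  have E: "fps_nth E i = 0" if "i < N" for i
  proof (cases "i < L")
    case True
    then show ?thesis by (simp add: E_def P_def p_def coeff_truncate_fps)
  next
    case False
    then have "i = L + (i - L)" "i - L < M" using that by (auto simp: N_def L_def)
    then show ?thesis using gap[of "i - L"] False
      by (simp add: E_def P_def p_def coeff_truncate_fps)
  qed
  have f_unit: "f * inverse f = 1"
    by (simp add: f_def inverse_mult_eq_1')
  have degq: "degree q \<le> M - 1"
    by (intro degree_le) (auto simp: coeff_q)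
  \<comment> \<open>Otherwise \<open>q f\<close>, hence also \<open>q\<close>, would vanish to order \<open>N > deg q\<close>.\<close>
  have p0: "p \<noteq> 0"
  proof
    assume "p = 0"
    then have 1: "Q * f = - E" by (simp add: E_def P_def)
    have "Q = (Q * f) * inverse f" using f_unit by (simp add: mult.assoc)
    then have 2: "Q = - inverse f * E" by (simp add: 1)
    have "coeff q i = 0" for i
    proof (cases "i < M")
      case True
      then have "fps_nth (- inverse f * E) i = 0"
        by (intro fps_mult_nth_eq_0[of N] E) (auto simp: N_def)
      then show ?thesis using 2 by (metis Q_def fps_of_poly_nth)
    qed (simp add: coeff_q)
    then show False using q0 by (auto simp: poly_eq_iff)
  qed
  then have "L > 0" by (auto simp: p_def intro: gr0I)
  then have degp: "degree p \<le> L - 1"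
    unfolding p_def using degree_truncate_fps[of L "Q * f"] by simp
  define t where "t = [:1, 1:] * (p * pderiv q - pderiv p * q) + Polynomial.smult a (p * q)"
  have degt: "degree t < N - 1"
  proof -
    have t: "t = p * ([:1, 1:] * pderiv q) - ([:1, 1:] * pderiv p) * q + Polynomial.smult a (p * q)"
      by (simp add: t_def algebra_simps)
    have "degree t \<le> degree p + degree q"
      unfolding t
      by (intro degree_add_le degree_diff_le order_trans[OF degree_mult_le]
          order_trans[OF degree_smult_le] add_mono one_plus_X_pderiv order_refl)
    then show ?thesis using degp degq \<open>L > 0\<close> j0 by (simp add: L_def N_def)
  qed
  define T where "T = fps_of_poly t"
  have f': "(1 + fps_X) * fps_deriv f = fps_const a * f"
    unfolding f_def fps_binomial_deriv
    by (simp add: fps_divide_unit mult.assoc[symmetric] mult.commute[of "1 + fps_X"])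
       (simp add: mult.assoc inverse_mult_eq_1)
  have T: "T = (1 + fps_X) * (P * fps_deriv Q - fps_deriv P * Q) + fps_const a * (P * Q)"
  proof -
    have "fps_of_poly [:1, 1:] = (1 + fps_X :: 'a fps)"
      by (simp add: fps_of_poly_pCons)
    then show ?thesis
      unfolding T_def t_def P_def Q_def
      by (simp only: fps_of_poly_add fps_of_poly_diff fps_of_poly_mult fps_of_poly_smult
          fps_of_poly_pderiv)
  qed
  \<comment> \<open>The Wronskian of \<open>P\<close> and \<open>Q f\<close>, with \<open>f'\<close> eliminated. It does not change, up to sign, when
    \<open>Q f\<close> is replaced by the small error \<open>E\<close>.\<close>
  have "T * f = (1 + fps_X) * (P * fps_deriv (Q * f) - fps_deriv P * (Q * f))"
  proof -
    have "T * f = (1 + fps_X) * (P * fps_deriv Q - fps_deriv P * Q) * f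
        + P * Q * (fps_const a * f)"
      unfolding T by (simp add: algebra_simps)
    then show ?thesis unfolding f'[symmetric] by (simp add: algebra_simps)
  qed
  also have "Q * f = P - E" by (simp add: E_def)
  also have "(1 + fps_X) * (P * fps_deriv (P - E) - fps_deriv P * (P - E)) =
      ((1 + fps_X) * fps_deriv P) * E - ((1 + fps_X) * P) * fps_deriv E"
    by (simp add: algebra_simps)
  finally have Tf: "T * f = \<dots>" .
  have Z: "fps_nth (T * f) i = 0" if "i < N - 1" for i
    unfolding Tf fps_sub_nth
    using that by (subst (1 2) fps_mult_nth_eq_0[of "N - 1"]) (simp_all add: E)
  have invT: "fps_nth (inverse f * (T * f)) i = 0" if "i < N - 1" for i
    using Z that by (rule fps_mult_nth_eq_0)
  have "inverse f * (T * f) = T * (f * inverse f)" by (simp only: mult_ac)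
  then have "inverse f * (T * f) = T" by (simp only: f_unit mult_1_right)
  then have "coeff t i = 0" if "i < N - 1" for i
    using invT[OF that] by (simp only: T_def fps_of_poly_nth)
  then have "t = 0"
    using degt by (metis leading_coeff_0_iff)
  then show False
    using binomial_ode_no_polynomial_pair[OF a p0 q0] by (simp add: t_def)
qed

section \<open>Determinants graded by weights\<close>

lemma prod_graded:
  fixes f :: "'b \<Rightarrow> 'a :: comm_semiring_1 poly"
  assumes "\<And>x. x \<in> A \<Longrightarrow> degree (f x) \<le> d x"
  shows "degree (prod f A) \<le> sum d A \<and> coeff (prod f A) (sum d A) = (\<Prod>x\<in>A. coeff (f x) (d x))"
  using assms
proof (induction A rule: infinite_finite_induct)
  case (insert x A)
  then show ?case
    using degree_mult_le[of "f x" "prod f A"]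
    by (auto simp: coeff_mult_graded intro: order_trans add_mono)
qed simp_all

lemma sum_permuted_weights:
  fixes w u :: "nat \<Rightarrow> nat"
  assumes "\<pi> permutes {0..<n}"
  shows "(\<Sum>i=0..<n. w i + u (\<pi> i)) = sum w {0..<n} + sum u {0..<n}"
  using sum.permute[OF assms, of u] by (simp add: sum.distrib comp_def)

text \<open>
  The weights \<open>w i + u j\<close> have the same sum along every permutation, so taking the coefficient at
  this sum commutes with the determinant.
\<close>

lemma det_graded:
  fixes f :: "nat \<Rightarrow> nat \<Rightarrow> 'a :: comm_ring_1 poly" and w u :: "nat \<Rightarrow> nat" and n :: nat
  assumes "\<And>i j. degree (f i j) \<le> w i + u j"
  defines "D \<equiv> Determinant.det (Matrix.mat n n (\<lambda>(i, j). f i j))"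
    and "s \<equiv> sum w {0..<n} + sum u {0..<n}"
  shows "degree D \<le> s"
    and "coeff D s = Determinant.det (Matrix.mat n n (\<lambda>(i, j). coeff (f i j) (w i + u j)))"
proof -
  have D: "D = (\<Sum>\<pi> | \<pi> permutes {0..<n}. signof \<pi> * (\<Prod>i=0..<n. f i (\<pi> i)))"
    unfolding D_def by (subst det_def'[of _ n]) (auto intro!: sum.cong prod.cong)
  have P: "degree (\<Prod>i=0..<n. f i (\<pi> i)) \<le> s \<and>
      coeff (\<Prod>i=0..<n. f i (\<pi> i)) s = (\<Prod>i=0..<n. coeff (f i (\<pi> i)) (w i + u (\<pi> i)))"
    if "\<pi> permutes {0..<n}" for \<pi>
    using prod_graded[of "{0..<n}" "\<lambda>i. f i (\<pi> i)" "\<lambda>i. w i + u (\<pi> i)"] assms(1)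
    by (simp add: sum_permuted_weights[OF that] s_def)
  show "degree D \<le> s"
    unfolding D using P by (intro degree_sum_le) (auto simp: sign_def finite_permutations)
  have "coeff D s = (\<Sum>\<pi> | \<pi> permutes {0..<n}.
      signof \<pi> * (\<Prod>i=0..<n. coeff (f i (\<pi> i)) (w i + u (\<pi> i))))"
    unfolding D coeff_sum using P by (intro sum.cong) (auto simp: sign_def)
  then show "coeff D s = Determinant.det (Matrix.mat n n (\<lambda>(i, j). coeff (f i j) (w i + u j)))"
    by (subst det_def'[of _ n]) (auto intro!: sum.cong prod.cong)
qed

lemma det_scaled_by_weights:
  fixes x :: "'a :: comm_ring_1" and w u :: "nat \<Rightarrow> nat"
  shows "Determinant.det (Matrix.mat n n (\<lambda>(i, j). x ^ (w i + u j) * g i j)) =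
    x ^ (sum w {0..<n} + sum u {0..<n}) * Determinant.det (Matrix.mat n n (\<lambda>(i, j). g i j))"
    (is "Determinant.det ?A = ?c * Determinant.det ?B")
proof -
  have "Determinant.det ?A =
      (\<Sum>\<pi> | \<pi> permutes {0..<n}. signof \<pi> * (\<Prod>i=0..<n. x ^ (w i + u (\<pi> i)) * g i (\<pi> i)))"
    by (subst det_def'[of _ n]) (auto intro!: sum.cong prod.cong)
  also have "\<dots> = (\<Sum>\<pi> | \<pi> permutes {0..<n}. ?c * (signof \<pi> * (\<Prod>i=0..<n. g i (\<pi> i))))"
    by (intro sum.cong)
       (simp_all add: prod.distrib power_sum[symmetric] sum_permuted_weights algebra_simps)
  also have "\<dots> = ?c * Determinant.det ?B"
    by (subst det_def'[of _ n])
       (auto simp: sum_distrib_left[symmetric] intro!: sum.cong prod.cong)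
  finally show ?thesis .
qed

section \<open>The Taylor coefficients as polynomials\<close>

text \<open>
  The series \<open>\<surd>(1 + c x)\<close>.
\<close>

definition sqrt_series :: "complex \<Rightarrow> complex fps" where
  "sqrt_series c = Abs_fps (\<lambda>n. c ^ n * ((1/2) gchoose n))"

text \<open>
  The same series for a \<open>c\<close> that depends polynomially on a parameter (\<open>\<lambda>\<close> or \<open>r\<close>). Keeping the
  parameter inside the coefficients makes each Taylor coefficient visibly a polynomial.
\<close>

definition sqrt_series_poly :: "complex poly \<Rightarrow> complex poly fps" where
  "sqrt_series_poly p = Abs_fps (\<lambda>n. Polynomial.smult ((1/2) gchoose n) (p ^ n))"

definition eval_fps_coeffs :: "complex poly fps \<Rightarrow> complex \<Rightarrow> complex fps" where
  "eval_fps_coeffs F x = Abs_fps (\<lambda>n. poly (fps_nth F n) x)"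

text \<open>
  For a series that is graded in the sense below, this is its part of highest weight, or its limit
  under the substitution \<open>t = s/\<lambda>\<close>, \<open>\<lambda> \<rightarrow> \<infinity>\<close>. As such it is multiplicative.
\<close>

definition top_coeffs :: "complex poly fps \<Rightarrow> complex fps" where
  "top_coeffs F = Abs_fps (\<lambda>n. coeff (fps_nth F n) n)"

definition graded :: "complex poly fps \<Rightarrow> bool" where
  "graded F \<longleftrightarrow> (\<forall>n. degree (fps_nth F n) \<le> n)"

lemma sqrt_series_square: "sqrt_series c * sqrt_series c = fps_const c * fps_X + 1"
proof -
  have "sqrt_series c = fps_compose (fps_binomial (1/2)) (fps_const c * fps_X)"
    by (simp add: sqrt_series_def fps_compose_linear)
  then have "sqrt_series c * sqrt_series c =
      fps_compose (fps_binomial (1/2) * fps_binomial (1/2)) (fps_const c * fps_X)"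
    by (simp add: fps_compose_mult_distrib)
  also have "fps_binomial (1/2) * fps_binomial (1/2) = (1 + fps_X :: complex fps)"
    by (simp add: fps_binomial_add_mult[symmetric] fps_binomial_1)
  finally show ?thesis
    by (simp add: fps_compose_add_distrib)
qed

lemma sqrt_series_0 [simp]: "sqrt_series 0 = 1"
  by (rule fps_ext) (simp add: sqrt_series_def power_0_left)

lemma sqrt_series_mult_scale:
  "fps_nth (sqrt_series x * sqrt_series (r * x)) k =
     x ^ k * fps_nth (sqrt_series 1 * sqrt_series r) k"
  unfolding fps_mult_nth sum_distrib_left
proof (rule sum.cong)
  fix i assume "i \<in> {0..k}"
  then have "x ^ k = x ^ i * x ^ (k - i)" by (simp flip: power_add)
  then show "fps_nth (sqrt_series x) i * fps_nth (sqrt_series (r * x)) (k - i) =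
      x ^ k * (fps_nth (sqrt_series 1) i * fps_nth (sqrt_series r) (k - i))"
    by (simp add: sqrt_series_def power_mult_distrib)
qed simp

lemma eval_fps_coeffs_mult:
  "eval_fps_coeffs (F * G) x = eval_fps_coeffs F x * eval_fps_coeffs G x"
  by (rule fps_ext) (simp add: eval_fps_coeffs_def fps_mult_nth poly_sum)

lemma eval_sqrt_series_poly:
  "eval_fps_coeffs (sqrt_series_poly p) x = sqrt_series (poly p x)"
  by (rule fps_ext) (simp add: eval_fps_coeffs_def sqrt_series_poly_def sqrt_series_def poly_power)

lemma graded_mult:
  assumes "graded F" "graded G"
  shows "graded (F * G)"
  unfolding graded_def fps_mult_nth
proof
  fix n
  have "degree (fps_nth F i * fps_nth G (n - i)) \<le> n" if "i \<in> {0..n}" for i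
  proof -
    have "degree (fps_nth F i) \<le> i" "degree (fps_nth G (n - i)) \<le> n - i"
      using assms by (auto simp: graded_def)
    then show ?thesis
      using that degree_mult_le[of "fps_nth F i" "fps_nth G (n - i)"] by simp
  qed
  then show "degree (\<Sum>i=0..n. fps_nth F i * fps_nth G (n - i)) \<le> n"
    by (intro degree_sum_le) auto
qed

lemma top_coeffs_mult:
  assumes "graded F" "graded G"
  shows "top_coeffs (F * G) = top_coeffs F * top_coeffs G"
proof (rule fps_ext)
  fix n
  have "coeff (fps_nth F i * fps_nth G (n - i)) n =
      coeff (fps_nth F i) i * coeff (fps_nth G (n - i)) (n - i)" if "i \<in> {0..n}" for i
    using coeff_mult_graded[of "fps_nth F i" i "fps_nth G (n - i)" "n - i"] assms that
    by (simp add: graded_def)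
  then show "fps_nth (top_coeffs (F * G)) n = fps_nth (top_coeffs F * top_coeffs G) n"
    by (simp add: top_coeffs_def fps_mult_nth coeff_sum)
qed

lemma graded_sqrt_series_poly:
  assumes "degree p \<le> 1"
  shows "graded (sqrt_series_poly p)"
  unfolding graded_def
proof
  fix n
  have "degree (p ^ n) \<le> degree p * n" by (rule degree_power_le)
  also have "\<dots> \<le> n" using assms by simp
  finally show "degree (fps_nth (sqrt_series_poly p) n) \<le> n"
    by (simp add: sqrt_series_poly_def)
qed

lemma top_coeffs_sqrt_series_poly:
  assumes "degree p \<le> 1"
  shows "top_coeffs (sqrt_series_poly p) = sqrt_series (coeff p 1)"
proof (rule fps_ext)
  fix n
  have "coeff (p ^ n) n = coeff p 1 ^ n"
    using prod_graded[of "{..<n}" "\<lambda>_. p" "\<lambda>_. 1"] assms by simp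
  then show "fps_nth (top_coeffs (sqrt_series_poly p)) n = fps_nth (sqrt_series (coeff p 1)) n"
    by (simp add: top_coeffs_def sqrt_series_poly_def sqrt_series_def)
qed

definition B_series :: "real \<Rightarrow> real \<Rightarrow> complex poly fps" where
  "B_series a b = sqrt_series_poly [:1, - 1 / of_real a:] *
     sqrt_series_poly [:1, - 1 / of_real b:] * sqrt_series_poly 1"

text \<open>
  A power series has at most one square root with constant term \<open>1\<close>: two of them, \<open>F\<close> and \<open>G\<close>,
  satisfy \<open>(F - G) (F + G) = 0\<close>, and \<open>F + G\<close> has constant term \<open>2\<close>.
\<close>

lemma B_poly_eq:
  assumes "a \<noteq> 0" "b \<noteq> 0"
  shows "B_poly a b k = fps_nth (B_series a b) k"
proof (rule poly_ext)
  fix l :: complex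
  define F where "F = fps_expansion
       (\<lambda>t. csqrt (((of_real a - l) / of_real a * t + 1) *
                   ((of_real b - l) / of_real b * t + 1) * (t + 1))) 0"
  define G where "G = eval_fps_coeffs (B_series a b) l"
  have G: "G = sqrt_series ((of_real a - l) / of_real a) *
      sqrt_series ((of_real b - l) / of_real b) * sqrt_series 1"
    using assms
    by (simp add: G_def B_series_def eval_fps_coeffs_mult eval_sqrt_series_poly diff_divide_distrib)
  have "G * G = (fps_const ((of_real a - l) / of_real a) * fps_X + 1) *
      (fps_const ((of_real b - l) / of_real b) * fps_X + 1) * (fps_const 1 * fps_X + 1)"
    unfolding G sqrt_series_square[symmetric] by (simp only: mult_ac)
  then have "F * F = G * G"
    using B_coeff_fps_square(1)[of a l b] by (simp add: F_def)
  then have "(F - G) * (F + G) = 0" by (simp add: algebra_simps)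
  moreover have "fps_nth F 0 = 1" using B_coeff_fps_square(2)[of a l b] by (simp add: F_def)
  then have "fps_nth (F + G) 0 \<noteq> 0" by (simp add: G sqrt_series_def)
  then have "F + G \<noteq> 0" by (metis fps_zero_nth)
  ultimately have "F = G" by simp
  then show "poly (B_poly a b k) l = poly (fps_nth (B_series a b) k) l"
    unfolding poly_B_poly B_coeff_def F_def[symmetric] by (simp add: G_def eval_fps_coeffs_def)
qed

text \<open>
  The Taylor coefficients of \<open>\<surd>((1 + x) (1 + r x))\<close> as polynomials in \<open>r\<close>.
\<close>

definition ratio_poly :: "nat \<Rightarrow> complex poly" where
  "ratio_poly k = fps_nth (sqrt_series_poly 1 * sqrt_series_poly [:0, 1:]) k"

lemma poly_ratio_poly: "poly (ratio_poly k) r = fps_nth (sqrt_series 1 * sqrt_series r) k"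
proof -
  have "poly (ratio_poly k) r =
      fps_nth (eval_fps_coeffs (sqrt_series_poly 1 * sqrt_series_poly [:0, 1:]) r) k"
    by (simp add: ratio_poly_def eval_fps_coeffs_def)
  then show ?thesis by (simp add: eval_fps_coeffs_mult eval_sqrt_series_poly)
qed

text \<open>
  The highest weight part of each factor \<open>\<surd>(1 + (1 - \<lambda>/c) t)\<close> is \<open>\<surd>(1 - s/c)\<close>, and that of
  \<open>\<surd>(1 + t)\<close> is \<open>1\<close>. Taking \<open>x = - s/a\<close> as the variable leaves only the ratio \<open>a/b\<close> as a parameter.
\<close>

lemma B_poly_top:
  assumes "a \<noteq> 0" "b \<noteq> 0"
  shows "degree (B_poly a b k) \<le> k"
    and "coeff (B_poly a b k) k =
      (- 1 / of_real a) ^ k * poly (ratio_poly k) (of_real (a / b))"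
proof -
  have g: "graded (sqrt_series_poly [:1, - 1 / of_real a:])"
    "graded (sqrt_series_poly [:1, - 1 / of_real b:])" "graded (sqrt_series_poly 1)"
    by (intro graded_sqrt_series_poly; simp)+
  show "degree (B_poly a b k) \<le> k"
    using graded_mult[OF graded_mult[OF g(1,2)] g(3)] assms
    by (simp add: B_poly_eq B_series_def graded_def)
  have "top_coeffs (B_series a b) = sqrt_series (- 1 / of_real a) * sqrt_series (- 1 / of_real b)"
    unfolding B_series_def using g by (simp add: top_coeffs_mult graded_mult top_coeffs_sqrt_series_poly)
  also have "- 1 / of_real b = of_real (a / b) * (- 1 / of_real a :: complex)"
    using assms by simp
  finally have "top_coeffs (B_series a b) =
      sqrt_series (- 1 / of_real a) * sqrt_series (of_real (a / b) * (- 1 / of_real a))" .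
  moreover have "coeff (B_poly a b k) k = fps_nth (top_coeffs (B_series a b)) k"
    using assms by (simp add: B_poly_eq top_coeffs_def)
  ultimately show "coeff (B_poly a b k) k =
      (- 1 / of_real a) ^ k * poly (ratio_poly k) (of_real (a / b))"
    by (simp only: sqrt_series_mult_scale poly_ratio_poly)
qed

section \<open>The degree\<close>

lemma half_not_Int: "(1/2 :: complex) \<notin> \<int>"
  using fraction_not_in_Ints[of 2 1, where ?'a = complex] by simp

text \<open>
  The bad ratios are the roots of the Hankel determinant of the \<^const>\<open>ratio_poly\<close>, which is not the
  zero polynomial because at \<open>r = 0\<close> it is a Hankel determinant of \<open>\<surd>(1 + x)\<close>.
\<close>

lemma degree_Hankel_B_poly:
  "\<exists>R :: real set. finite R \<and> (\<forall>a b. a \<noteq> 0 \<longrightarrow> b \<noteq> 0 \<longrightarrow> a / b \<notin> R \<longrightarrow>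
     degree (Determinant.det (Matrix.mat M M (\<lambda>(i, j). B_poly a b (i + j + k)))) =
       (\<Sum>i=0..<M. i) + (\<Sum>j=0..<M. j + k))"
proof -
  define D where "D = Determinant.det (Matrix.mat M M (\<lambda>(i, j). ratio_poly (i + j + k)))"
  have poly_D: "poly D r =
      Determinant.det (Matrix.mat M M (\<lambda>(i, j). poly (ratio_poly (i + j + k)) r))" for r
  proof -
    interpret ev: comm_ring_hom "\<lambda>p :: complex poly. poly p r"
      by unfold_locales auto
    show ?thesis
      unfolding D_def ev.hom_det[symmetric]
      by (intro arg_cong[of _ _ Determinant.det] eq_matI) auto
  qed
  have "poly D 0 = Determinant.det (Matrix.mat M M (\<lambda>(i, j). (1/2) gchoose (i + j + k)))"
    by (simp add: poly_D poly_ratio_poly) (simp add: sqrt_series_def)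
  then have "D \<noteq> 0"
    using det_binomial_Hankel_nonzero[OF half_not_Int, of M k] by auto
  define R where "R = {r :: real. poly D (of_real r) = 0}"
  have "finite (of_real -` {z. poly D z = 0} :: real set)"
    using \<open>D \<noteq> 0\<close> by (intro finite_vimageI poly_roots_finite) (auto simp: inj_def)
  then have "finite R" by (simp add: R_def vimage_def)
  moreover have "degree (Determinant.det (Matrix.mat M M (\<lambda>(i, j). B_poly a b (i + j + k)))) =
       (\<Sum>i=0..<M. i) + (\<Sum>j=0..<M. j + k)" (is "degree ?B = ?s")
    if "a \<noteq> 0" "b \<noteq> 0" "a / b \<notin> R" for a b
  proof (rule antisym)
    have deg: "degree (B_poly a b (i + j + k)) \<le> i + (j + k)" for i j
      using B_poly_top(1)[OF that(1,2), of "i + j + k"] by (simp add: add.assoc)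
    show "degree ?B \<le> ?s"
      by (rule det_graded(1)[of "\<lambda>i j. B_poly a b (i + j + k)" "\<lambda>i. i" "\<lambda>j. j + k"]) (rule deg)
    have "coeff ?B ?s =
        Determinant.det (Matrix.mat M M (\<lambda>(i, j). coeff (B_poly a b (i + j + k)) (i + (j + k))))"
      by (rule det_graded(2)[of "\<lambda>i j. B_poly a b (i + j + k)" "\<lambda>i. i" "\<lambda>j. j + k"]) (rule deg)
    also have "\<dots> = Determinant.det (Matrix.mat M M (\<lambda>(i, j). (- 1 / of_real a) ^ (i + (j + k)) *
        poly (ratio_poly (i + j + k)) (of_real (a / b))))"
      using B_poly_top(2)[OF that(1,2)] by (simp only: add.assoc)
    also have "\<dots> = (- 1 / of_real a) ^ ?s * poly D (of_real (a / b))"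
      unfolding poly_D by (rule det_scaled_by_weights)
    also have "\<dots> \<noteq> 0"
      using that unfolding R_def by simp
    finally show "?s \<le> degree ?B" by (rule le_degree)
  qed
  ultimately show ?thesis by blast
qed

theorem proposition2p22:
  fixes n :: nat
  assumes "n \<ge> 3"
  shows "\<exists>R :: real set. finite R \<and>
           (\<forall>a b :: real. a \<noteq> 0 \<longrightarrow> b \<noteq> 0 \<longrightarrow> a / b \<notin> R \<longrightarrow>
              real (degree (cayley_det_poly n a b)) =
                (if odd n then ((real n)\<^sup>2 - 1) / 4 else (real n)\<^sup>2 / 4 - 1))"
proof -
  define m where "m = n div 2"
  define M k where "M = (if odd n then m else m - 1)" and "k = (if odd n then 2 else 3 :: nat)"
  have cayley: "cayley_det_poly n a b =
      Determinant.det (Matrix.mat M M (\<lambda>(i, j). B_poly a b (i + j + k)))" for a b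
    by (simp add: cayley_det_poly_def Let_def M_def k_def m_def numeral_eq_Suc)
  have sums: "real ((\<Sum>i=0..<M. i) + (\<Sum>j=0..<M. j + k)) = real M * (real M - 1 + real k)" for M k :: nat
    by (induction M) (simp_all add: algebra_simps)
  have deg_value: "real M * (real M - 1 + real k) =
      (if odd n then ((real n)\<^sup>2 - 1) / 4 else (real n)\<^sup>2 / 4 - 1)"
  proof (cases "odd n")
    case True
    then have "real n = 2 * real m + 1" unfolding m_def by (auto elim!: oddE)
    then show ?thesis using True by (simp add: M_def k_def power2_eq_square field_simps)
  next
    case False
    then have "n = 2 * m" by (simp add: m_def)
    moreover from this have "m \<ge> 1" using assms by simp
    ultimately show ?thesis
      using False by (simp add: M_def k_def power2_eq_square field_simps of_nat_diff)
  qed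
  show ?thesis
    unfolding cayley deg_value[symmetric] sums[symmetric] of_nat_eq_iff
    by (rule degree_Hankel_B_poly)
qed

end
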